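(* Let $n\ge 1$ be an integer and let $p\vdash n$ be a partition of $n$. Let $r$ run over the set of orbits of the action of $S_n$ on $S_n\times S_n$ by simultaneous conjugation, $\gamma\cdot(\sigma_1,\sigma_2)=(\gamma\sigma_1\gamma^{-1},\gamma\sigma_2\gamma^{-1})$ (these orbits are in bijection with bipartite ribbon graphs with $n$ edges). Then $$\mathrm{Sym}(p)=\sum_{r}\frac{|\mathrm{Aut}(r)\cap[p]|}{|\mathrm{Aut}(r)|}.$$
   Context: A partition $p\vdash n$ is specified by the numbers $p_i$ of parts of length $i$, with $\sum_i i\,p_i=n$, and $\mathrm{Sym}(p)=\prod_{i=1}^n i^{p_i}\,p_i!$. $[p]\subset S_n$ is the conjugacy class of permutations whose cycle lengths form the partition $p$. For each orbit $r$ choose a representative $(\sigma_1^{(r)},\sigma_2^{(r)})$; then $\mathrm{Aut}(r)=\{\gamma\in S_n:\ \gamma\sigma_i^{(r)}\gamma^{-1}=\sigma_i^{(r)},\ i=1,2\}$ is its stabilizer. The numbers $|\mathrm{Aut}(r)|$ and $|\mathrm{Aut}(r)\cap[p]|$ do not depend on the choice of representative. *)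

theory Defs
  imports
    Complex_Main
    "HOL-Combinatorics.Orbits"
    "HOL-Algebra.Group_Action"
    "HOL-Algebra.Sym_Groups"
begin

text \<open>A partition of \<open>n\<close> is given by its multiplicity function: \<open>p i\<close> is the number of parts of
  length \<open>i\<close>. The first conjunct makes \<open>p\<close> vanish off \<open>{1..n}\<close>, so that \<open>p\<close> carries no junk
  values.\<close>

definition partition_of :: "(nat \<Rightarrow> nat) \<Rightarrow> nat \<Rightarrow> bool" where
  "partition_of p n \<longleftrightarrow> (\<forall>i. p i \<noteq> 0 \<longrightarrow> 1 \<le> i \<and> i \<le> n) \<and> (\<Sum>i = 1..n. i * p i) = n"

definition Sym :: "nat \<Rightarrow> (nat \<Rightarrow> nat) \<Rightarrow> nat" where
  "Sym n p = (\<Prod>i = 1..n. i ^ p i * fact (p i))"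

text \<open>A cycle of \<open>\<gamma>\<close> is identified with its underlying set; fixed points count as cycles of
  length 1.\<close>

definition cycle_class :: "nat \<Rightarrow> (nat \<Rightarrow> nat) \<Rightarrow> (nat \<Rightarrow> nat) set" where
  "cycle_class n p = {\<gamma> \<in> carrier (sym_group n).
     \<forall>i \<in> {1..n}. card {C. C \<subseteq> {1..n} \<and> cyclic_on \<gamma> C \<and> card C = i} = p i}"

text \<open>Restricted to \<open>carrier G \<times> carrier G\<close> because \<^const>\<open>group_action\<close> requires extensional
  bijections.\<close>

definition simul_conj :: "('a, 'b) monoid_scheme \<Rightarrow> 'a \<Rightarrow> 'a \<times> 'a \<Rightarrow> 'a \<times> 'a" where
  "simul_conj G \<gamma> = (\<lambda>(\<sigma>\<^sub>1, \<sigma>\<^sub>2) \<in> carrier G \<times> carrier G.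
     (\<gamma> \<otimes>\<^bsub>G\<^esub> \<sigma>\<^sub>1 \<otimes>\<^bsub>G\<^esub> inv\<^bsub>G\<^esub> \<gamma>, \<gamma> \<otimes>\<^bsub>G\<^esub> \<sigma>\<^sub>2 \<otimes>\<^bsub>G\<^esub> inv\<^bsub>G\<^esub> \<gamma>))"

lemma (in group) simul_conj_closed:
  assumes "g \<in> carrier G" "x \<in> carrier G \<times> carrier G"
  shows "simul_conj G g x \<in> carrier G \<times> carrier G"
  using assms by (auto simp: simul_conj_def)

lemma (in group) simul_conj_mult:
  assumes "g \<in> carrier G" "h \<in> carrier G" "x \<in> carrier G \<times> carrier G"
  shows "simul_conj G (g \<otimes> h) x = simul_conj G g (simul_conj G h x)"
  using assms by (auto simp: simul_conj_def inv_mult_group m_assoc)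

lemma (in group) simul_conj_one:
  assumes "x \<in> carrier G \<times> carrier G"
  shows "simul_conj G \<one> x = x"
  using assms by (auto simp: simul_conj_def)

lemma (in group) simul_conj_inverse:
  assumes "g \<in> carrier G" "x \<in> carrier G \<times> carrier G"
  shows "simul_conj G (inv g) (simul_conj G g x) = x"
    and "simul_conj G g (simul_conj G (inv g) x) = x"
  using assms by (simp_all add: simul_conj_mult [symmetric] simul_conj_one del: SigmaE)

lemma (in group) simul_conj_Bij:
  assumes "g \<in> carrier G"
  shows "simul_conj G g \<in> Bij (carrier G \<times> carrier G)"
proof -
  have "bij_betw (simul_conj G g) (carrier G \<times> carrier G) (carrier G \<times> carrier G)"
    using assms
    by (intro bij_betw_byWitness [where f' = "simul_conj G (inv g)"] ballI image_subsetI
          simul_conj_inverse simul_conj_closed inv_closed)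
  then show ?thesis
    by (simp add: Bij_def simul_conj_def)
qed

lemma (in group) simul_conj_action:
  "group_action G (carrier G \<times> carrier G) (simul_conj G)"
proof -
  let ?E = "carrier G \<times> carrier G"
  have "simul_conj G (g \<otimes> h) = compose ?E (simul_conj G g) (simul_conj G h)"
    if "g \<in> carrier G" "h \<in> carrier G" for g h
  proof
    fix x
    show "simul_conj G (g \<otimes> h) x = compose ?E (simul_conj G g) (simul_conj G h) x"
    proof (cases "x \<in> ?E")
      case True
      then show ?thesis
        using that by (simp only: simul_conj_mult compose_eq)
    next
      case False
      then show ?thesis
        by (simp only: simul_conj_def compose_def restrict_def if_False)
    qed
  qed
  then have "simul_conj G \<in> hom G (BijGroup ?E)"
    by (auto simp: hom_def BijGroup_def simul_conj_Bij)
  then show ?thesis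
    by (simp add: group_action_def group_hom_def group_hom_axioms_def group_BijGroup is_group)
qed

definition pair_orbits :: "nat \<Rightarrow> ((nat \<Rightarrow> nat) \<times> (nat \<Rightarrow> nat)) set set" where
  "pair_orbits n = orbits (sym_group n) (carrier (sym_group n) \<times> carrier (sym_group n))
     (simul_conj (sym_group n))"

definition Aut :: "nat \<Rightarrow> (nat \<Rightarrow> nat) \<times> (nat \<Rightarrow> nat) \<Rightarrow> (nat \<Rightarrow> nat) set" where
  "Aut n = stabilizer (sym_group n) (simul_conj (sym_group n))"

end

theory Submission
  imports Defs
begin

text \<open>Burnside's counting argument, restricted to group elements of the conjugacy class \<open>[p]\<close>,
  turns the sum over orbits into \<open>1/n!\<close> times the sum over \<open>\<gamma> \<in> [p]\<close> of the number of fixed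
  points of \<open>\<gamma>\<close>. A pair is fixed by \<open>\<gamma>\<close> iff both entries centralise \<open>\<gamma>\<close>, so this number is
  the square of the order of the centraliser, \<open>Sym(p)\<^sup>2\<close>; and \<open>[p]\<close> has \<open>n!/Sym(p)\<close> elements.

  The order of the centraliser and the fact that \<open>[p]\<close> is a single conjugacy class come from one
  count: between any two permutations of cycle type \<open>p\<close> there are exactly \<open>Sym(p)\<close> intertwining
  bijections. Choosing the image of one point, in a cycle of length \<open>i\<close>, leaves \<open>i p\<^sub>i\<close>
  possibilities and fixes the bijection on that whole cycle; the rest is induction.\<close>

subsection \<open>Burnside's lemma for a union of conjugacy classes\<close>

text \<open>Conjugation by \<open>g\<close> is injective and carries elements fixing
  \<open>x\<close> to elements fixing \<open>\<phi> g x\<close>, while \<open>P\<close> is closed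
  under it. The inequality suffices, as \<open>inv g\<close> supplies the reverse one.\<close>

lemma (in group_action) card_stabilizer_Int_le:
  assumes fin: "finite (carrier G)"
    and P: "\<And>g h. g \<in> carrier G \<Longrightarrow> h \<in> P \<Longrightarrow> g \<otimes> h \<otimes> inv g \<in> P"
    and x: "x \<in> E" and g: "g \<in> carrier G"
  shows "card (stabilizer G \<phi> x \<inter> P) \<le> card (stabilizer G \<phi> (\<phi> g x) \<inter> P)"
proof (rule card_inj_on_le)
  interpret group G
    using group_hom group_hom.axioms(1) by blast
  show "inj_on (\<lambda>h. g \<otimes> h \<otimes> inv g) (stabilizer G \<phi> x \<inter> P)"
    using g by (intro inj_onI) (auto simp: stabilizer_def)
  have "\<phi> (g \<otimes> h \<otimes> inv g) (\<phi> g x) = \<phi> g x" if "h \<in> carrier G" "\<phi> h x = x" for h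
  proof -
    have "\<phi> g x \<in> E" "\<phi> (inv g) (\<phi> g x) = x"
      using element_image[OF g x] orbit_sym_aux[OF g x] by auto
    with that g x show ?thesis
      by (simp add: composition_rule)
  qed
  then show "(\<lambda>h. g \<otimes> h \<otimes> inv g) ` (stabilizer G \<phi> x \<inter> P) \<subseteq> stabilizer G \<phi> (\<phi> g x) \<inter> P"
    using g P by (auto simp: stabilizer_def)
  show "finite (stabilizer G \<phi> (\<phi> g x) \<inter> P)"
    using fin stabilizer_subset finite_subset by blast
qed

text \<open>Both inequalities come from the preceding lemma, applied to \<open>g\<close> and to
  \<open>inv g\<close>. This is why the summand does not depend on the representative of the
  orbit.\<close>

lemma (in group_action) card_stabilizer_Int_eq:
  assumes fin: "finite (carrier G)"
    and P: "\<And>g h. g \<in> carrier G \<Longrightarrow> h \<in> P \<Longrightarrow> g \<otimes> h \<otimes> inv g \<in> P"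
    and x: "x \<in> E" and y: "y \<in> Group_Action.orbit G \<phi> x"
  shows "card (stabilizer G \<phi> y \<inter> P) = card (stabilizer G \<phi> x \<inter> P)"
proof -
  interpret group G
    using group_hom group_hom.axioms(1) by blast
  obtain g where g: "g \<in> carrier G" and yg: "y = \<phi> g x"
    using y by (auto simp: Group_Action.orbit_def)
  have yE: "y \<in> E"
    using element_image g x yg by blast
  have "\<phi> (inv g) y = x"
    using orbit_sym_aux[OF g x] yg by blast
  then show ?thesis
    using card_stabilizer_Int_le[OF fin P x g] card_stabilizer_Int_le[OF fin P yE, of "inv g"] g yg
    by (simp add: le_antisym)
qed

text \<open>Double counting of the pairs of a point \<open>x\<close> and an element \<open>g\<close>
  of \<open>P\<close> with \<open>\<phi> g x = x\<close>. For \<open>P = carrier G\<close> every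
  summand is 1 and this is the usual Burnside lemma.\<close>

lemma (in group_action) burnside_conj_closed:
  assumes fin: "finite (carrier G)" and finE: "finite E"
    and PG: "P \<subseteq> carrier G"
    and P: "\<And>g h. g \<in> carrier G \<Longrightarrow> h \<in> P \<Longrightarrow> g \<otimes> h \<otimes> inv g \<in> P"
    and rep: "\<And>r. r \<in> orbits G E \<phi> \<Longrightarrow> rep r \<in> r"
  shows "(\<Sum>r\<in>orbits G E \<phi>. real (card (stabilizer G \<phi> (rep r) \<inter> P))
            / real (card (stabilizer G \<phi> (rep r)))) * real (order G)
         = real (\<Sum>g\<in>P. card (invariants E \<phi> g))"
proof -
  interpret group G
    using group_hom group_hom.axioms(1) by blast
  have finP: "finite P"
    using PG fin finite_subset by blast
  have part: "\<Union>(orbits G E \<phi>) = E" "\<And>r. r \<in> orbits G E \<phi> \<Longrightarrow> finite r"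
    "\<And>r s. r \<in> orbits G E \<phi> \<Longrightarrow> s \<in> orbits G E \<phi> \<Longrightarrow> r \<noteq> s \<Longrightarrow> r \<inter> s = {}"
  proof -
    show U: "\<Union>(orbits G E \<phi>) = E"
      using partition.partition_coverture[OF orbit_partition] by simp
    show "finite r" if "r \<in> orbits G E \<phi>" for r
      using that U finE by (auto intro: finite_subset[of r E])
    show "r \<inter> s = {}" if "r \<in> orbits G E \<phi>" "s \<in> orbits G E \<phi>" "r \<noteq> s" for r s
      using partition.disjoint_union[OF orbit_partition that(1,2)] that(3) by blast
  qed
  \<comment> \<open>By the orbit-stabilizer theorem the group order divided by the stabilizer order
    is \<open>card r\<close>, and the numerator is constant on \<open>r\<close>; so the term becomes
    a sum over the points of \<open>r\<close>.\<close>
  have orb: "real (card (stabilizer G \<phi> (rep r) \<inter> P)) / real (card (stabilizer G \<phi> (rep r)))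
      * real (order G) = real (\<Sum>x\<in>r. card (stabilizer G \<phi> x \<inter> P))"
    if r: "r \<in> orbits G E \<phi>" for r
  proof -
    obtain x where x: "x \<in> E" and rx: "r = Group_Action.orbit G \<phi> x"
      using r by (auto simp: orbits_def)
    have y: "rep r \<in> r" "rep r \<in> E"
      using rep[OF r] part(1) r by auto
    \<comment> \<open>\<open>r\<close> is known only as the orbit of some \<open>x\<close>. The
      orbit of \<open>rep r\<close> meets it in \<open>rep r\<close>, so disjointness of distinct
      orbits identifies the two.\<close>
    have "r = Group_Action.orbit G \<phi> (rep r)"
    proof -
      obtain z where "z \<in> orbits G E \<phi>" "z = Group_Action.orbit G \<phi> (rep r)"
        using y(2) by (auto simp: orbits_def)
      then show ?thesis
        using part(3)[of r z] r y orbit_refl[of "rep r"] by blast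
    qed
    then have o: "card r * card (stabilizer G \<phi> (rep r)) = order G"
      and c: "\<And>y. y \<in> r \<Longrightarrow> card (stabilizer G \<phi> y \<inter> P) = card (stabilizer G \<phi> (rep r) \<inter> P)"
      using orbit_stabilizer_theorem[OF y(2)] card_stabilizer_Int_eq[OF fin P y(2)] by auto
    have "card (stabilizer G \<phi> (rep r)) \<noteq> 0"
    proof
      assume "card (stabilizer G \<phi> (rep r)) = 0"
      with o show False
        using fin order_gt_0_iff_finite by simp
    qed
    then show ?thesis
      by (simp add: c o[symmetric])
  qed
  have "(\<Sum>r\<in>orbits G E \<phi>. real (card (stabilizer G \<phi> (rep r) \<inter> P))
            / real (card (stabilizer G \<phi> (rep r)))) * real (order G)
       = real (\<Sum>r\<in>orbits G E \<phi>. \<Sum>x\<in>r. card (stabilizer G \<phi> x \<inter> P))"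
    unfolding sum_distrib_right by (subst of_nat_sum) (intro sum.cong refl orb)
  also have "(\<Sum>r\<in>orbits G E \<phi>. \<Sum>x\<in>r. card (stabilizer G \<phi> x \<inter> P))
      = (\<Sum>x\<in>E. card (stabilizer G \<phi> x \<inter> P))"
    using part by (subst sum.Union_disjoint[symmetric, unfolded o_def]) auto
  also have "\<dots> = (\<Sum>x\<in>E. \<Sum>g\<in>P. if \<phi> g x = x then 1 else 0)"
    using PG finP by (intro sum.cong refl card_as_sums) (auto simp: stabilizer_def)
  also have "\<dots> = (\<Sum>g\<in>P. \<Sum>x\<in>E. if \<phi> g x = x then 1 else 0)"
    by (rule sum.swap)
  also have "\<dots> = (\<Sum>g\<in>P. card (invariants E \<phi> g))"
    using finE by (intro sum.cong refl card_as_sums[symmetric]) (auto simp: invariants_def)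
  finally show ?thesis .
qed

text \<open>A pair is fixed exactly when each entry commutes with \<open>g\<close>, so the fixed
  points form the square of the centraliser.\<close>

lemma (in group) card_invariants_simul_conj:
  assumes "g \<in> carrier G"
  shows "card (invariants (carrier G \<times> carrier G) (simul_conj G) g)
    = (card {h \<in> carrier G. h \<otimes> g = g \<otimes> h})\<^sup>2"
proof -
  have "g \<otimes> h \<otimes> inv g = h \<longleftrightarrow> h \<otimes> g = g \<otimes> h" if "h \<in> carrier G" for h
    using assms that by (metis inv_solve_right' m_closed)
  then have "invariants (carrier G \<times> carrier G) (simul_conj G) g
      = {h \<in> carrier G. h \<otimes> g = g \<otimes> h} \<times> {h \<in> carrier G. h \<otimes> g = g \<otimes> h}"
    by (auto simp: invariants_def simul_conj_def)
  then show ?thesis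
    by (simp add: card_cartesian_product power2_eq_square)
qed

subsection \<open>Counting the cycles of a permutation\<close>

text \<open>The count in \<open>cycle_class\<close> with \<open>{1..n}\<close> replaced by any set,
  so that an induction can remove one cycle at a time.\<close>

definition cycle_count :: "('a \<Rightarrow> 'a) \<Rightarrow> 'a set \<Rightarrow> nat \<Rightarrow> nat" where
  "cycle_count f A i = card {C. C \<subseteq> A \<and> cyclic_on f C \<and> card C = i}"

lemma invariant_orbit_subset:
  assumes "f ` A \<subseteq> A" "a \<in> A"
  shows "Orbits.orbit f a \<subseteq> A"
proof
  fix y assume "y \<in> Orbits.orbit f a"
  then show "y \<in> A"
    by induct (use assms in auto)
qed

text \<open>Orbits of a permutation are also closed under preimages, because \<open>x\<close> and
  \<open>f x\<close> have the same orbit.\<close>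

lemma invariant_Diff_orbit:
  assumes f: "permutation f" and A: "f ` A \<subseteq> A"
  shows "f ` (A - Orbits.orbit f a) \<subseteq> A - Orbits.orbit f a"
proof -
  have "x \<in> Orbits.orbit f a" if "f x \<in> Orbits.orbit f a" for x
    using that permutation_self_in_orbit[OF f, of x] permutation_orbit_step[OF f, of x]
    by (metis Orbits.orbit_trans)
  then show ?thesis
    using A by auto
qed

text \<open>The points on cycles of length \<open>i\<close> are partitioned by these cycles, each
  holding \<open>i\<close> of them.\<close>

lemma mult_cycle_count:
  assumes f: "permutation f" and A: "f ` A \<subseteq> A" "finite A"
  shows "card {a \<in> A. card (Orbits.orbit f a) = i} = i * cycle_count f A i"
proof -
  let ?Cs = "{C. C \<subseteq> A \<and> cyclic_on f C \<and> card C = i}"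
  have U: "{a \<in> A. card (Orbits.orbit f a) = i} = \<Union>?Cs"
  proof (intro equalityI subsetI)
    fix a assume "a \<in> {a \<in> A. card (Orbits.orbit f a) = i}"
    then have "Orbits.orbit f a \<in> ?Cs"
      using invariant_orbit_subset[OF A(1)] cyclic_on_orbit'[OF f] by auto
    then show "a \<in> \<Union>?Cs"
      using permutation_self_in_orbit[OF f] by blast
  next
    fix a assume "a \<in> \<Union>?Cs"
    then show "a \<in> {a \<in> A. card (Orbits.orbit f a) = i}"
      by (auto simp: orbit_cyclic_eq3)
  qed
  have "i * card ?Cs = card (\<Union>?Cs)"
  proof (rule card_partition)
    show "finite ?Cs" "finite (\<Union>?Cs)"
      using A(2) by (auto intro: finite_subset[of _ "Pow A"] finite_subset[of _ A])
    show "C \<inter> D = {}" if "C \<in> ?Cs" "D \<in> ?Cs" "C \<noteq> D" for C D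
    proof -
      have "cyclic_on f C" "cyclic_on f D"
        using that by auto
      then show ?thesis
        using that(3) by (metis disjoint_iff orbit_cyclic_eq3)
    qed
  qed auto
  with U show ?thesis
    by (simp add: cycle_count_def)
qed

text \<open>Two cycles are equal or disjoint, so removing the cycle of \<open>a\<close> leaves every
  other cycle intact.\<close>

lemma cycle_count_Diff_orbit:
  assumes f: "permutation f" and A: "f ` A \<subseteq> A" "finite A" "a \<in> A"
  shows "cycle_count f A j = cycle_count f (A - Orbits.orbit f a) j
    + (if j = card (Orbits.orbit f a) then 1 else 0)"
proof -
  let ?O = "Orbits.orbit f a"
  let ?D = "{C. C \<subseteq> A - ?O \<and> cyclic_on f C \<and> card C = j}"
  have O: "?O \<subseteq> A" "cyclic_on f ?O" "a \<in> ?O"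
    using invariant_orbit_subset[OF A(1,3)] cyclic_on_orbit'[OF f] permutation_self_in_orbit[OF f]
    by auto
  have disj: "C = ?O \<or> C \<inter> ?O = {}" if "cyclic_on f C" for C
    using that O(2) orbit_cyclic_eq3 by (metis disjoint_iff)
  have "{C. C \<subseteq> A \<and> cyclic_on f C \<and> card C = j} = ?D \<union> (if j = card ?O then {?O} else {})"
    using O disj by auto
  moreover have "finite ?D" "?O \<notin> ?D"
    using A(2) O(3) by (auto intro: finite_subset[of _ "Pow A"])
  ultimately show ?thesis
    unfolding cycle_count_def by (cases "j = card ?O") auto
qed

lemma cycle_count_image:
  assumes h: "bij_betw h A B" and eq: "\<And>x. x \<in> A \<Longrightarrow> h (f x) = g (h x)"
    and A: "f ` A \<subseteq> A"
  shows "cycle_count g B i = cycle_count f A i"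
proof -
  have "bij_betw ((`) h) {C. C \<subseteq> A \<and> cyclic_on f C \<and> card C = i}
     {C. C \<subseteq> B \<and> cyclic_on g C \<and> card C = i}"
    unfolding bij_betw_def
  proof (intro conjI equalityI subsetI)
    show "inj_on ((`) h) {C. C \<subseteq> A \<and> cyclic_on f C \<and> card C = i}"
      using h by (intro inj_on_subset[OF inj_on_image_Pow[of h A]]) (auto simp: bij_betw_def)
    fix D
    assume "D \<in> (`) h ` {C. C \<subseteq> A \<and> cyclic_on f C \<and> card C = i}"
    then obtain C where C: "C \<subseteq> A" "cyclic_on f C" "card C = i" "D = h ` C"
      by auto
    have "cyclic_on g (h ` C)"
      using C eq by (intro cyclic_on_image[OF C(2)]) (auto simp: subset_iff)
    moreover have "h ` C \<subseteq> B" "card (h ` C) = i"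
      using C h by (auto simp: bij_betw_def card_image inj_on_subset)
    ultimately show "D \<in> {C. C \<subseteq> B \<and> cyclic_on g C \<and> card C = i}"
      using C by auto
  next
    fix D
    assume "D \<in> {C. C \<subseteq> B \<and> cyclic_on g C \<and> card C = i}"
    then have D: "D \<subseteq> B" "cyclic_on g D" "card D = i"
      by auto
    let ?k = "inv_into A h"
    have k: "bij_betw ?k B A"
      using h by (rule bij_betw_inv_into)
    \<comment> \<open>The inverse intertwines in the other direction: with \<open>x = ?k y\<close>,
      \<open>g y\<close> equals \<open>h (f x)\<close>, and \<open>f x\<close> is again in
      \<open>A\<close> by invariance.\<close>
    have "f (?k y) = ?k (g y)" if "y \<in> B" for y
      using that eq[of "?k y"] A h k
      by (metis bij_betw_apply bij_betw_inv_into_left bij_betw_inv_into_right image_subset_iff)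
    then have "cyclic_on f (?k ` D)"
      using D by (intro cyclic_on_image[OF D(2)]) (auto simp: subset_iff)
    moreover have "?k ` D \<subseteq> A" "card (?k ` D) = i"
      using D k by (auto simp: bij_betw_def card_image inj_on_subset)
    moreover have "h ` ?k ` D = D"
      using D(1) h by (metis bij_betw_imp_surj_on image_inv_into_cancel)
    ultimately show "D \<in> (`) h ` {C. C \<subseteq> A \<and> cyclic_on f C \<and> card C = i}"
      by (metis (mono_tags, lifting) image_eqI mem_Collect_eq)
  qed
  from bij_betw_same_card[OF this] show ?thesis
    by (simp add: cycle_count_def)
qed

subsection \<open>Bijections intertwining two permutations\<close>

text \<open>Extensionality outside \<open>A\<close> makes the set finite, with one element per bijection.\<close>

definition intertwiners :: "('a \<Rightarrow> 'a) \<Rightarrow> 'a set \<Rightarrow> ('b \<Rightarrow> 'b) \<Rightarrow> 'b set \<Rightarrow> ('a \<Rightarrow> 'b) set" where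
  "intertwiners f A g B = {h \<in> extensional A. bij_betw h A B \<and> (\<forall>x\<in>A. h (f x) = g (h x))}"

text \<open>The first return time \<open>funpow_dist1 f x x\<close> equals the size of the orbit.
  Iterates repeat with this period and are distinct within one period.\<close>

lemma funpow_eq_iff_mod_card_orbit:
  assumes f: "permutation f"
  shows "(f ^^ m) x = (f ^^ k) x \<longleftrightarrow>
    m mod card (Orbits.orbit f x) = k mod card (Orbits.orbit f x)"
proof -
  have self: "x \<in> Orbits.orbit f x"
    using f by (rule permutation_self_in_orbit)
  let ?d = "funpow_dist1 f x x"
  have inj: "inj_on (\<lambda>n. (f ^^ n) x) {0..<?d}"
    using self by (rule inj_on_funpow_dist1)
  have d: "card (Orbits.orbit f x) = ?d"
    by (subst orbit_conv_funpow_dist1[OF self], subst card_image[OF inj]) simp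
  have "(f ^^ n) x = (f ^^ (n mod ?d)) x" for n
    using funpow_mod_eq[OF funpow_dist1_prop[OF self]] by metis
  then have "(f ^^ m) x = (f ^^ k) x \<longleftrightarrow> (f ^^ (m mod ?d)) x = (f ^^ (k mod ?d)) x"
    by simp
  also have "\<dots> \<longleftrightarrow> m mod ?d = k mod ?d"
    using inj by (auto simp: inj_on_def)
  finally show ?thesis
    by (simp only: d)
qed

lemma orbit_intertwiner_exists:
  assumes f: "permutation f" and g: "permutation g"
    and card: "card (Orbits.orbit f a) = card (Orbits.orbit g b)"
  shows "\<exists>h. bij_betw h (Orbits.orbit f a) (Orbits.orbit g b) \<and> h a = b \<and>
    (\<forall>x\<in>Orbits.orbit f a. h (f x) = g (h x))"
proof -
  \<comment> \<open>\<open>f\<^sup>k a \<mapsto> g\<^sup>k b\<close>, which does not depend on the choice of \<open>k\<close> by \<open>same\<close>\<close>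
  define h where "h x = (g ^^ (SOME k. (f ^^ k) a = x)) b" for x
  have same: "(f ^^ k) a = (f ^^ m) a \<longleftrightarrow> (g ^^ k) b = (g ^^ m) b" for k m
    by (simp add: funpow_eq_iff_mod_card_orbit f g card)
  have hk: "h ((f ^^ k) a) = (g ^^ k) b" for k
    unfolding h_def using same someI[of "\<lambda>m. (f ^^ m) a = (f ^^ k) a" k] by blast
  have "h a = b"
    using hk[of 0] by simp
  moreover have "h (f x) = g (h x)" if x: "x \<in> Orbits.orbit f a" for x
  proof -
    obtain k where "x = (f ^^ k) a"
      using x by (auto simp: orbit_altdef_permutation[OF f])
    then show ?thesis
      using hk[of k] hk[of "Suc k"] by simp
  qed
  moreover have "bij_betw h (Orbits.orbit f a) (Orbits.orbit g b)"
    unfolding bij_betw_def orbit_altdef_permutation[OF f] orbit_altdef_permutation[OF g]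
    using same by (auto simp: inj_on_def image_def hk)
  ultimately show ?thesis
    by blast
qed

text \<open>Hence the value at \<open>a\<close> determines an intertwiner on the whole cycle of
  \<open>a\<close>. The induction also carries membership in \<open>A\<close>, since
  \<open>h\<close> is controlled only there.\<close>

lemma intertwiner_funpow:
  assumes h: "\<And>x. x \<in> A \<Longrightarrow> h (f x) = g (h x)" and A: "f ` A \<subseteq> A" "a \<in> A"
  shows "h ((f ^^ k) a) = (g ^^ k) (h a)"
proof -
  have "(f ^^ k) a \<in> A \<and> h ((f ^^ k) a) = (g ^^ k) (h a)"
    by (induction k) (use h A in auto)
  then show ?thesis ..
qed

text \<open>An intertwiner amounts to an image \<open>b\<close> of \<open>a\<close> on a cycle of
  the same length, which fixes it on the cycle of \<open>a\<close>, and an intertwiner between the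
  complements of the two cycles.\<close>

lemma card_intertwiners_rec:
  assumes f: "permutation f" and A: "f ` A \<subseteq> A" "finite A" "a \<in> A"
    and g: "permutation g" and B: "g ` B \<subseteq> B" "finite B"
  shows "card (intertwiners f A g B) =
    (\<Sum>b | b \<in> B \<and> card (Orbits.orbit g b) = card (Orbits.orbit f a).
       card (intertwiners f (A - Orbits.orbit f a) g (B - Orbits.orbit g b)))"
proof -
  let ?C = "Orbits.orbit f a"
  let ?Bi = "{b. b \<in> B \<and> card (Orbits.orbit g b) = card ?C}"
  let ?S = "SIGMA b : ?Bi. intertwiners f (A - ?C) g (B - Orbits.orbit g b)"
  have CA: "?C \<subseteq> A" and aC: "a \<in> ?C"
    using invariant_orbit_subset[OF A(1,3)] permutation_self_in_orbit[OF f] by auto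
  have DB: "Orbits.orbit g b \<subseteq> B" if "b \<in> B" for b
    using invariant_orbit_subset[OF B(1) that] .
  have inv: "f ` (A - ?C) \<subseteq> A - ?C"
    by (rule invariant_Diff_orbit[OF f A(1)])
  have "bij_betw (\<lambda>h. (h a, restrict h (A - ?C))) (intertwiners f A g B) ?S"
    unfolding bij_betw_def
  proof (intro conjI equalityI subsetI)
    show "inj_on (\<lambda>h. (h a, restrict h (A - ?C))) (intertwiners f A g B)"
    proof (rule inj_onI)
      fix h k
      assume hk: "h \<in> intertwiners f A g B" "k \<in> intertwiners f A g B"
        and "(h a, restrict h (A - ?C)) = (k a, restrict k (A - ?C))"
      then have eqa: "h a = k a" and eqr: "restrict h (A - ?C) = restrict k (A - ?C)"
        by auto
      have "h x = k x" if "x \<in> A" for x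
      proof (cases "x \<in> ?C")
        case True
        then obtain m where "x = (f ^^ m) a"
          by (auto simp: orbit_altdef_permutation[OF f])
        then show ?thesis
          using hk eqa A intertwiner_funpow[of A h f g a m] intertwiner_funpow[of A k f g a m]
          by (auto simp: intertwiners_def)
      next
        case False
        then show ?thesis
          using that fun_cong[OF eqr, of x] by simp
      qed
      then show "h = k"
        using hk by (auto simp: intertwiners_def intro: extensionalityI[of _ A])
    qed
  next
    fix z assume "z \<in> (\<lambda>h. (h a, restrict h (A - ?C))) ` intertwiners f A g B"
    then obtain h where h: "bij_betw h A B" "\<And>x. x \<in> A \<Longrightarrow> h (f x) = g (h x)"
      and z: "z = (h a, restrict h (A - ?C))"
      by (auto simp: intertwiners_def)
    \<comment> \<open>An intertwiner maps cycles onto cycles; thus lengths agree and the complements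
      correspond.\<close>
    have im: "h ` ?C = Orbits.orbit g (h a)"
      using CA h(2) by (intro orbit_inverse[OF aC]) (auto simp: subset_iff)
    have "h a \<in> B"
      using h(1) A(3) bij_betw_apply by fastforce
    moreover have "card (Orbits.orbit g (h a)) = card ?C"
      using CA h(1) by (metis bij_betw_def card_image im inj_on_subset)
    moreover have "bij_betw h (A - ?C) (B - Orbits.orbit g (h a))"
      using h(1) CA im by (metis bij_betw_subset Diff_subset bij_betw_def inj_on_image_set_diff)
    then have "restrict h (A - ?C) \<in> intertwiners f (A - ?C) g (B - Orbits.orbit g (h a))"
      using h(2) inv by (auto simp: intertwiners_def)
    ultimately show "z \<in> ?S"
      using z by simp
  next
    fix z assume "z \<in> ?S"
    then obtain b k where z: "z = (b, k)" and b: "b \<in> B" "card (Orbits.orbit g b) = card ?C"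
      and k: "k \<in> extensional (A - ?C)" "bij_betw k (A - ?C) (B - Orbits.orbit g b)"
        "\<And>x. x \<in> A - ?C \<Longrightarrow> k (f x) = g (k x)"
      by (auto simp: intertwiners_def)
    obtain l where l: "bij_betw l ?C (Orbits.orbit g b)" "l a = b"
      "\<And>x. x \<in> ?C \<Longrightarrow> l (f x) = g (l x)"
      using orbit_intertwiner_exists[OF f g b(2)[symmetric]] by metis
    \<comment> \<open>For surjectivity, the bijection of the two cycles sending \<open>a\<close> to
      \<open>b\<close> is glued to the given \<open>k\<close> on the complement.\<close>
    define h where "h x = (if x \<in> ?C then l x else k x)" for x
    have "bij_betw h (?C \<union> (A - ?C)) (Orbits.orbit g b \<union> (B - Orbits.orbit g b))"
    proof (rule bij_betw_combine)
      show "bij_betw h ?C (Orbits.orbit g b)"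
        by (rule iffD2[OF bij_betw_cong l(1)]) (simp add: h_def)
      show "bij_betw h (A - ?C) (B - Orbits.orbit g b)"
        by (rule iffD2[OF bij_betw_cong k(2)]) (simp add: h_def)
    qed auto
    moreover have "?C \<union> (A - ?C) = A" "Orbits.orbit g b \<union> (B - Orbits.orbit g b) = B"
      using CA DB[OF b(1)] by auto
    ultimately have "bij_betw h A B"
      by simp
    moreover have "h (f x) = g (h x)" if "x \<in> A" for x
      using that l(3)[of x] k(3)[of x] inv orbit.step[of x f a] by (auto simp: h_def)
    moreover have "h \<in> extensional A"
      using k(1) CA by (auto simp: h_def extensional_def)
    moreover have "h a = b" "restrict h (A - ?C) = k"
      using l(2) aC k(1) by (auto simp: h_def extensional_def)
    ultimately show "z \<in> (\<lambda>h. (h a, restrict h (A - ?C))) ` intertwiners f A g B"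
      unfolding z intertwiners_def by force
  qed
  then have "card (intertwiners f A g B) = card ?S"
    by (rule bij_betw_same_card)
  also have "\<dots> = (\<Sum>b\<in>?Bi. card (intertwiners f (A - ?C) g (B - Orbits.orbit g b)))"
  proof (rule card_SigmaI)
    show "\<forall>b\<in>?Bi. finite (intertwiners f (A - ?C) g (B - Orbits.orbit g b))"
    proof
      fix b
      have "intertwiners f (A - ?C) g (B - Orbits.orbit g b) \<subseteq> (A - ?C) \<rightarrow>\<^sub>E B"
        by (auto simp: intertwiners_def bij_betw_def PiE_def)
      then show "finite (intertwiners f (A - ?C) g (B - Orbits.orbit g b))"
        using A(2) B(2) by (meson finite_Diff finite_PiE finite_subset)
    qed
  qed (use B(2) in auto)
  finally show ?thesis .
qed

text \<open>Let \<open>a\<close> lie on a cycle of length i, and let c be the number of such cycles.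
  There are i * c images for \<open>a\<close>, each leaving counts with c lowered by one, and i * c
  * i^(c-1) * (c-1)! = i^c * c!. The bound \<open>n\<close> keeps the range of the product fixed
  during the induction; lengths that do not occur contribute the factor 1.\<close>

lemma card_intertwiners:
  assumes f: "permutation f" and g: "permutation g"
    and "f ` A \<subseteq> A" "finite A" "g ` B \<subseteq> B" "finite B" "card A \<le> n"
    and "\<And>i. cycle_count f A i = cycle_count g B i"
  shows "card (intertwiners f A g B) = Sym n (cycle_count f A)"
  using assms(3-)
proof (induction "card A" arbitrary: A B rule: less_induct)
  case less
  show ?case
  proof (cases "A = {}")
    case True
    have no_cycle: "cycle_count f A i = 0" for i
      by (simp add: True cycle_count_def cyclic_on_def)
    have "B = {}"
    proof (rule ccontr)
      assume "B \<noteq> {}"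
      then obtain b where "b \<in> B" by auto
      then have "0 < cycle_count g B (card (Orbits.orbit g b))"
        using cycle_count_Diff_orbit[OF g \<open>g ` B \<subseteq> B\<close> \<open>finite B\<close>, of b] by simp
      then show False
        using less.prems(6) no_cycle by simp
    qed
    \<comment> \<open>Only the empty bijection remains, matching the value 1 of the product.\<close>
    then have "intertwiners f A g B = {\<lambda>_. undefined}"
      using True by (auto simp: intertwiners_def bij_betw_def)
    then show ?thesis
      by (simp add: Sym_def no_cycle)
  next
    case False
    then obtain a where a: "a \<in> A" by auto
    let ?C = "Orbits.orbit f a"
    let ?i = "card ?C"
    have CA: "?C \<subseteq> A" and aC: "a \<in> ?C"
      using invariant_orbit_subset[OF \<open>f ` A \<subseteq> A\<close> a] permutation_self_in_orbit[OF f] by auto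
    have finC: "finite ?C"
      using CA \<open>finite A\<close> finite_subset by blast
    have i: "?i \<in> {1..n}"
      using CA aC finC \<open>finite A\<close> \<open>card A \<le> n\<close> card_mono[OF \<open>finite A\<close> CA]
      by (auto simp: Suc_le_eq card_gt_0_iff)
    have lt: "card (A - ?C) < card A"
      using aC a \<open>finite A\<close> by (intro psubset_card_mono) auto
    have "card (intertwiners f (A - ?C) g (B - Orbits.orbit g b))
        = Sym n (cycle_count f (A - ?C))"
      if b: "b \<in> B" "card (Orbits.orbit g b) = ?i" for b
    proof (rule less.hyps[OF lt])
      show "f ` (A - ?C) \<subseteq> A - ?C" "g ` (B - Orbits.orbit g b) \<subseteq> B - Orbits.orbit g b"
        by (rule invariant_Diff_orbit[OF f \<open>f ` A \<subseteq> A\<close>] invariant_Diff_orbit[OF g \<open>g ` B \<subseteq> B\<close>])+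
      show "card (A - ?C) \<le> n"
        using lt \<open>card A \<le> n\<close> by simp
      show "cycle_count f (A - ?C) j = cycle_count g (B - Orbits.orbit g b) j" for j
        using cycle_count_Diff_orbit[OF f \<open>f ` A \<subseteq> A\<close> \<open>finite A\<close> a, of j]
          cycle_count_Diff_orbit[OF g \<open>g ` B \<subseteq> B\<close> \<open>finite B\<close> b(1), of j] b(2)
          less.prems(6)[of j] by simp
    qed (use less.prems in auto)
    then have "card (intertwiners f A g B)
        = card {b \<in> B. card (Orbits.orbit g b) = ?i} * Sym n (cycle_count f (A - ?C))"
      using card_intertwiners_rec[OF f \<open>f ` A \<subseteq> A\<close> \<open>finite A\<close> a g \<open>g ` B \<subseteq> B\<close> \<open>finite B\<close>]
      by simp
    also have "\<dots> = ?i * cycle_count f A ?i * Sym n (cycle_count f (A - ?C))"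
      using mult_cycle_count[OF g \<open>g ` B \<subseteq> B\<close> \<open>finite B\<close>] less.prems(6) by simp
    also have "\<dots> = Sym n (cycle_count f A)"
    proof -
      \<comment> \<open>Removing the cycle changes only the factor at its own length.\<close>
      have "(\<Prod>j\<in>{1..n} - {?i}. j ^ cycle_count f A j * fact (cycle_count f A j))
          = (\<Prod>j\<in>{1..n} - {?i}. j ^ cycle_count f (A - ?C) j * fact (cycle_count f (A - ?C) j))"
        by (intro prod.cong refl)
          (simp add: cycle_count_Diff_orbit[OF f \<open>f ` A \<subseteq> A\<close> \<open>finite A\<close> a])
      moreover have "cycle_count f A ?i = Suc (cycle_count f (A - ?C) ?i)"
        using cycle_count_Diff_orbit[OF f \<open>f ` A \<subseteq> A\<close> \<open>finite A\<close> a, of ?i] by simp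
      ultimately show ?thesis
        by (simp only: Sym_def prod.remove[OF finite_atLeastAtMost i]) (simp add: algebra_simps)
    qed
    finally show ?thesis .
  qed
qed

subsection \<open>Permutations of given cycle type\<close>

text \<open>A cycle inside \<open>A\<close> is nonempty and no larger than \<open>A\<close>. This
  settles the lengths outside \<open>{1..n}\<close>, where a cycle type prescribes nothing.\<close>

lemma cycle_count_eq_0:
  assumes "finite A" "i = 0 \<or> card A < i"
  shows "cycle_count f A i = 0"
proof -
  have "0 < card C \<and> card C \<le> card A" if "C \<subseteq> A" "cyclic_on f C" for C
    using that assms(1) finite_cyclic_on[OF that(2)]
    by (auto simp: card_mono card_gt_0_iff cyclic_on_def)
  then have "\<not> (C \<subseteq> A \<and> cyclic_on f C \<and> card C = i)" for C
    using assms(2) by (metis leD less_irrefl)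
  then have "{C. C \<subseteq> A \<and> cyclic_on f C \<and> card C = i} = {}"
    by blast
  then show ?thesis
    by (simp only: cycle_count_def card.empty)
qed

lemma exists_cyclic_permutation:
  assumes "finite C" "C \<noteq> {}"
  shows "\<exists>c. c permutes C \<and> cyclic_on c C"
proof -
  obtain cs where cs: "set cs = C" "distinct cs"
    using finite_distinct_list[OF assms(1)] by auto
  let ?c = "cycle_of_list cs"
  have ne: "cs \<noteq> []"
    using cs(1) assms(2) by auto
  \<comment> \<open>Powers of the cycle act on \<open>cs\<close> as rotations, so the orbit of its
    first entry runs through the whole list.\<close>
  have pow: "(?c ^^ k) (cs ! 0) = cs ! (k mod length cs)" for k
  proof -
    have "(?c ^^ k) (cs ! 0) = map (?c ^^ k) cs ! 0"
      using ne by simp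
    also have "\<dots> = rotate k cs ! 0"
      using cyclic_rotation[OF cs(2)] by simp
    also have "\<dots> = cs ! (k mod length cs)"
      using ne by (subst nth_rotate) simp_all
    finally show ?thesis .
  qed
  have perm: "?c permutes C"
    using cycle_permutes[of cs] cs(1) by simp
  have "Orbits.orbit ?c (cs ! 0) = range (\<lambda>k. cs ! (k mod length cs))"
    using perm assms(1)
    by (subst orbit_altdef_permutation) (auto simp: permutation_permutes pow)
  also have "\<dots> = C"
  proof (intro equalityI subsetI)
    fix x assume "x \<in> C"
    then obtain i where "i < length cs" "x = cs ! i"
      using cs(1) by (auto simp: in_set_conv_nth)
    then show "x \<in> range (\<lambda>k. cs ! (k mod length cs))"
      by (intro range_eqI[of _ _ i]) simp
  qed (use ne cs(1) in auto)
  finally show ?thesis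
    using perm cyclic_on_orbit[OF perm assms(1), of "cs ! 0"] by auto
qed

text \<open>Shows that the class of a partition is nonempty. A cycle of an occurring length
  \<open>i\<close> is split off, and the rest is permuted according to \<open>p\<close> with
  \<open>p i\<close> lowered by one.\<close>

lemma exists_permutation_of_cycle_type:
  assumes "finite A" "(\<Sum>i = 1..n. i * p i) = card A"
  shows "\<exists>f. f permutes A \<and> (\<forall>i\<in>{1..n}. cycle_count f A i = p i)"
  using assms
proof (induction "card A" arbitrary: A p rule: less_induct)
  case less
  show ?case
  proof (cases "\<forall>i\<in>{1..n}. p i = 0")
    case True
    then have "card A = 0"
      using less.prems(2) by simp
    then have "cycle_count id A i = p i" if "i \<in> {1..n}" for i
      using that True less.prems(1) by (simp add: cycle_count_eq_0)
    then show ?thesis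
      using permutes_id by blast
  next
    case False
    then obtain i where i: "i \<in> {1..n}" "0 < p i"
      by auto
    let ?q = "p(i := p i - 1)"
    have "(\<Sum>j\<in>{1..n} - {i}. j * ?q j) = (\<Sum>j\<in>{1..n} - {i}. j * p j)"
      by (intro sum.cong) auto
    then have sum: "(\<Sum>j = 1..n. j * p j) = (\<Sum>j = 1..n. j * ?q j) + i"
      using i(2) by (cases "p i")
        (simp_all only: sum.remove[OF finite_atLeastAtMost i(1)], simp_all)
    obtain C where C: "C \<subseteq> A" "card C = i" "finite C"
      using sum less.prems(2) by (metis le_add2 obtain_subset_with_card_n)
    have "C \<noteq> {}"
      using C(2) i(1) by auto
    then obtain a where a: "a \<in> C"
      by auto
    obtain c where c: "c permutes C" "cyclic_on c C"
      using exists_cyclic_permutation[OF C(3) \<open>C \<noteq> {}\<close>] by auto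
    have card: "card (A - C) + i = card A"
      using C card_mono[OF less.prems(1) C(1)] by (simp add: card_Diff_subset)
    have "card (A - C) < card A" "finite (A - C)" "(\<Sum>j = 1..n. j * ?q j) = card (A - C)"
      using card i(1) less.prems sum by auto
    from less.hyps[OF this] obtain f where f: "f permutes A - C"
      "\<And>j. j \<in> {1..n} \<Longrightarrow> cycle_count f (A - C) j = ?q j"
      by blast
    \<comment> \<open>\<open>c\<close> moves only points of \<open>C\<close> and \<open>f\<close>
      only points outside, so the composite has the cycle \<open>C\<close> together with the cycles
      of \<open>f\<close> on \<open>A - C\<close>.\<close>
    let ?F = "f \<circ> c"
    have F: "?F permutes A"
      using f(1) c(1) C(1) by (intro permutes_compose) (auto intro: permutes_subset)
    have "cyclic_on ?F C"
      using permutes_comp_preserves_cyclic2[OF f(1) c(2)] by blast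
    then have orb: "Orbits.orbit ?F a = C"
      using a by (rule orbit_cyclic_eq3)
    have "?F x = f x" if "x \<in> A - C" for x
      using that c(1) by (simp add: permutes_not_in)
    then have "cyclic_on ?F D = cyclic_on f D" if "D \<subseteq> A - C" for D
      using that by (intro cyclic_cong) auto
    then have rest: "cycle_count ?F (A - C) j = cycle_count f (A - C) j" for j
      by (simp add: cycle_count_def cong: conj_cong)
    have perm: "permutation ?F"
      using F less.prems(1) by (auto simp: permutation_permutes)
    have "cycle_count ?F A j = p j" if "j \<in> {1..n}" for j
      using cycle_count_Diff_orbit[OF perm _ less.prems(1), of a j] permutes_image[OF F] a C
        orb rest f(2)[OF that] i(2) by auto
    with F show ?thesis
      by blast
  qed
qed

section \<open>Centralisers and conjugacy classes in the symmetric group\<close>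

lemma card_commuting_eq_card_intertwiners:
  assumes f: "f permutes A" and g: "g permutes A"
  shows "card {h. h permutes A \<and> h \<circ> f = g \<circ> h} = card (intertwiners f A g A)"
proof (rule bij_betw_same_card, rule bij_betw_byWitness[where f' = "\<lambda>h. restrict_id h A"])
  \<comment> \<open>The two kinds of maps differ only outside \<open>A\<close>, where a permutation
    is the identity and an intertwiner is \<open>undefined\<close>; exchanging these defaults is the
    bijection.\<close>
  show "\<forall>h\<in>{h. h permutes A \<and> h \<circ> f = g \<circ> h}. restrict_id (restrict h A) A = h"
    by (auto simp: fun_eq_iff restrict_id_def permutes_not_in)
  show "\<forall>h\<in>intertwiners f A g A. restrict (restrict_id h A) A = h"
    by (auto simp: fun_eq_iff restrict_def intertwiners_def extensional_def)
  show "(\<lambda>h. restrict h A) ` {h. h permutes A \<and> h \<circ> f = g \<circ> h} \<subseteq> intertwiners f A g A"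
    using f by (auto simp: intertwiners_def permutes_imp_bij fun_eq_iff permutes_in_image)
  show "(\<lambda>h. restrict_id h A) ` intertwiners f A g A \<subseteq> {h. h permutes A \<and> h \<circ> f = g \<circ> h}"
  proof
    fix k assume "k \<in> (\<lambda>h. restrict_id h A) ` intertwiners f A g A"
    then obtain h where h: "bij_betw h A A" "\<And>x. x \<in> A \<Longrightarrow> h (f x) = g (h x)"
      and k: "k = restrict_id h A"
      by (auto simp: intertwiners_def)
    have "k (f x) = g (k x)" for x
      using h(2) f g by (cases "x \<in> A") (auto simp: k permutes_in_image permutes_not_in)
    then show "k \<in> {h. h permutes A \<and> h \<circ> f = g \<circ> h}"
      using permutes_restrict_id[OF h(1)] k by auto
  qed
qed

lemma cycle_class_eq:
  "cycle_class n p = {f. f permutes {1..n} \<and> (\<forall>i\<in>{1..n}. cycle_count f {1..n} i = p i)}"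
  by (simp add: cycle_class_def cycle_count_def sym_group_def)

text \<open>The case \<open>f = g\<close> gives the order of the centraliser; letting
  \<open>g\<close> vary gives the size of the class.\<close>

lemma card_cycle_class_intertwiners:
  assumes f: "f \<in> cycle_class n p" and g: "g \<in> cycle_class n p"
  shows "card {h. h permutes {1..n} \<and> h \<circ> f = g \<circ> h} = Sym n p"
proof -
  have perm: "f permutes {1..n}" "g permutes {1..n}"
    and count: "\<And>i. i \<in> {1..n} \<Longrightarrow> cycle_count f {1..n} i = p i"
      "\<And>i. i \<in> {1..n} \<Longrightarrow> cycle_count g {1..n} i = p i"
    using f g by (auto simp: cycle_class_eq)
  have "cycle_count f {1..n} i = cycle_count g {1..n} i" for i
    using count cycle_count_eq_0[of "{1..n}" i] by (cases "i \<in> {1..n}") (auto simp: Suc_le_eq)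
  then have "card (intertwiners f {1..n} g {1..n}) = Sym n (cycle_count f {1..n})"
    using perm permutes_image[OF perm(1)] permutes_image[OF perm(2)]
    by (intro card_intertwiners) (auto simp: permutation_permutes)
  also have "\<dots> = Sym n p"
    unfolding Sym_def using count by (intro prod.cong) auto
  finally show ?thesis
    by (simp only: card_commuting_eq_card_intertwiners[OF perm])
qed

lemma cycle_class_conj_closed:
  assumes g: "g \<in> carrier (sym_group n)" and h: "h \<in> cycle_class n p"
  shows "g \<otimes>\<^bsub>sym_group n\<^esub> h \<otimes>\<^bsub>sym_group n\<^esub> inv\<^bsub>sym_group n\<^esub> g \<in> cycle_class n p"
proof -
  interpret group "sym_group n"
    by (rule sym_group_is_group)
  let ?c = "g \<otimes>\<^bsub>sym_group n\<^esub> h \<otimes>\<^bsub>sym_group n\<^esub> inv\<^bsub>sym_group n\<^esub> g"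
  have hc: "h \<in> carrier (sym_group n)"
    using h by (simp add: cycle_class_def)
  \<comment> \<open>Written without the inverse, conjugacy says that \<open>g\<close> intertwines
    \<open>h\<close> with its conjugate, so the cycle counts agree.\<close>
  have "?c \<in> carrier (sym_group n)" "?c \<otimes>\<^bsub>sym_group n\<^esub> g = g \<otimes>\<^bsub>sym_group n\<^esub> h"
    using g hc by (simp_all add: m_assoc del: sym_group_inv_equality)
  then have c: "?c permutes {1..n}" "?c \<circ> g = g \<circ> h"
    by (simp_all only: sym_group_carrier sym_group_mult)
  have "cycle_count ?c {1..n} i = cycle_count h {1..n} i" for i
  proof (rule cycle_count_image)
    show "bij_betw g {1..n} {1..n}"
      using g by (simp add: sym_group_carrier permutes_imp_bij)
    show "g (h x) = ?c (g x)" for x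
      using fun_cong[OF c(2), of x] by simp
    show "h ` {1..n} \<subseteq> {1..n}"
      using hc permutes_image by (fastforce simp: sym_group_carrier)
  qed
  then show ?thesis
    using h c(1) by (simp add: cycle_class_eq del: sym_group_inv_equality)
qed

text \<open>Conjugating \<open>f\<close> maps the symmetric group into the class, and the fibre over
  each \<open>g\<close> in the class consists of the permutations intertwining \<open>f\<close> with
  \<open>g\<close>. All fibres thus have \<open>Sym n p\<close> elements.\<close>

lemma card_cycle_class_mult_Sym:
  assumes "f \<in> cycle_class n p"
  shows "card (cycle_class n p) * Sym n p = order (sym_group n)"
proof -
  interpret group "sym_group n"
    by (rule sym_group_is_group)
  let ?S = "carrier (sym_group n)"
  let ?conj = "\<lambda>h. h \<otimes>\<^bsub>sym_group n\<^esub> f \<otimes>\<^bsub>sym_group n\<^esub> inv\<^bsub>sym_group n\<^esub> h"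
  have fin: "finite ?S"
    by (simp add: sym_group_def finite_permutations)
  have sub: "cycle_class n p \<subseteq> ?S"
    by (auto simp: cycle_class_def)
  have "card {h \<in> ?S. ?conj h = g} = Sym n p" if g: "g \<in> cycle_class n p" for g
  proof -
    have "?conj h = g \<longleftrightarrow> h \<circ> f = g \<circ> h" if "h \<in> ?S" for h
    proof -
      have "?conj h = g \<longleftrightarrow> h \<otimes>\<^bsub>sym_group n\<^esub> f = g \<otimes>\<^bsub>sym_group n\<^esub> h"
        using that g sub assms by (intro inv_solve_right') auto
      then show ?thesis
        by (simp only: sym_group_mult)
    qed
    then have "{h \<in> ?S. ?conj h = g} = {h. h permutes {1..n} \<and> h \<circ> f = g \<circ> h}"
      by (auto simp only: sym_group_carrier mem_Collect_eq)
    then show ?thesis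
      using card_cycle_class_intertwiners[OF assms g] by simp
  qed
  then have "card (cycle_class n p) * Sym n p = (\<Sum>g\<in>cycle_class n p. \<Sum>h | h \<in> ?S \<and> ?conj h = g. 1)"
    by simp
  also have "\<dots> = (\<Sum>h\<in>?S. 1)"
    using fin finite_subset[OF sub fin] cycle_class_conj_closed assms
    by (intro sum.group) (auto simp del: sym_group_inv_equality)
  finally show ?thesis
    by (simp add: order_def)
qed

theorem mainTheorem4:
  fixes n :: nat and p :: "nat \<Rightarrow> nat"
    and rep :: "((nat \<Rightarrow> nat) \<times> (nat \<Rightarrow> nat)) set \<Rightarrow> (nat \<Rightarrow> nat) \<times> (nat \<Rightarrow> nat)"
  assumes "n \<ge> 1"
    and "partition_of p n"
    and "\<And>r. r \<in> pair_orbits n \<Longrightarrow> rep r \<in> r"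
  shows "real (Sym n p) =
    (\<Sum>r \<in> pair_orbits n. real (card (Aut n (rep r) \<inter> cycle_class n p)) / real (card (Aut n (rep r))))"
proof -
  interpret group "sym_group n"
    by (rule sym_group_is_group)
  let ?S = "carrier (sym_group n)"
  interpret act: group_action "sym_group n" "?S \<times> ?S" "simul_conj (sym_group n)"
    by (rule simul_conj_action)
  have fin: "finite ?S"
    by (simp add: sym_group_def finite_permutations)
  have sub: "cycle_class n p \<subseteq> ?S"
    by (auto simp: cycle_class_def)
  obtain f where f: "f \<in> cycle_class n p"
    using exists_permutation_of_cycle_type[of "{1..n}" p n] assms(2)
    by (auto simp: partition_of_def cycle_class_eq)
  have "card (invariants (?S \<times> ?S) (simul_conj (sym_group n)) g) = (Sym n p)\<^sup>2"
    if g: "g \<in> cycle_class n p" for g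
  proof -
    have "card {h \<in> ?S. h \<otimes>\<^bsub>sym_group n\<^esub> g = g \<otimes>\<^bsub>sym_group n\<^esub> h} = Sym n p"
      using card_cycle_class_intertwiners[OF g g] by (simp only: sym_group_carrier sym_group_mult)
    then show ?thesis
      using card_invariants_simul_conj g sub by auto
  qed
  then have "(\<Sum>r \<in> pair_orbits n. real (card (Aut n (rep r) \<inter> cycle_class n p)) / real (card (Aut n (rep r))))
      * real (order (sym_group n)) = real (card (cycle_class n p) * (Sym n p)\<^sup>2)"
    using act.burnside_conj_closed[OF fin _ sub cycle_class_conj_closed, of rep] fin assms(3)
    by (simp add: pair_orbits_def Aut_def)
  \<comment> \<open>One factor \<open>Sym n p\<close> combines with the size of the class to give
    the group order, which is then cancelled.\<close>
  also have "\<dots> = real (Sym n p) * real (order (sym_group n))"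
    by (simp add: card_cycle_class_mult_Sym[OF f, symmetric] power2_eq_square)
  finally show ?thesis
    using fin order_gt_0_iff_finite by simp
qed

end
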